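(* Let $m \geq 1$ and $n_1, \dots, n_m \geq 1$ be integers and let $\mu_1, \dots, \mu_m$ be real constants. Write points of $\mathbb{R}^{2n_1} \times \cdots \times \mathbb{R}^{2n_m}$ as $(X_1, Y_1, \dots, X_m, Y_m)$ with $X_j, Y_j \in \mathbb{R}^{n_j}$, and let $F_j = F_{\mathbb{R}^{2n_j}}(X_j, Y_j)$ be the (multi-valued) CH height function in the variables $(X_j, Y_j)$. Then the multi-valued graph $$ z = \sum_{j=1}^{m} \mu_j \, F_{\mathbb{R}^{2n_j}}(X_j, Y_j) $$ is a minimal hypersurface in the odd-dimensional Euclidean space $\mathbb{R}^{2n_1 + \cdots + 2n_m + 1}$.
   Context: For an integer $n \geq 1$, the CH (Choe-Hoppe) height function on $\mathbb{R}^{2n} = \mathbb{R}^n \times \mathbb{R}^n$ is $$F_{\mathbb{R}^{2n}}(X,Y) = \frac12 \arctan\left(\frac{V}{U}\right), \qquad U = \|X\|^2 - \|Y\|^2, \quad V = 2\langle X, Y\rangle,$$ with $\langle \cdot,\cdot\rangle$ and $\|\cdot\|$ the standard inner product and norm of $\mathbb{R}^n$. It is regarded as a multi-valued function on $\{(U,V) \neq (0,0)\}$: with $X = (x_1,\dots,x_n)$, $Y = (y_1,\dots,y_n)$, one has $U + iV = \sum_k (x_k + i y_k)^2$, and $F_{\mathbb{R}^{2n}}$ is the multi-valued function $\arg \sqrt{\sum_k (x_k+iy_k)^2}$, i.e. its local smooth branches are the local smooth branches of $\frac12 \arg(U+iV)$. A multi-valued graph $z = F$ is a minimal hypersurface if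 each local smooth branch of $F$, on the open set where the branch is defined, has a graph of zero mean curvature, i.e. satisfies the minimal hypersurface equation $$\nabla \cdot \left( \frac{\nabla F}{\sqrt{1 + \|\nabla F\|^2}} \right) = 0.$$ *)

theory Defs
  imports "HOL-Analysis.Analysis"
begin

definition partial_deriv :: "'d::finite \<Rightarrow> (real^'d \<Rightarrow> real) \<Rightarrow> real^'d \<Rightarrow> real" where
  "partial_deriv i f x = frechet_derivative f (at x) (axis i 1)"

definition gradient :: "(real^'d::finite \<Rightarrow> real) \<Rightarrow> real^'d \<Rightarrow> real^'d" where
  "gradient f x = (\<chi> i. partial_deriv i f x)"

definition divergence :: "(real^'d::finite \<Rightarrow> real^'d) \<Rightarrow> real^'d \<Rightarrow> real" where
  "divergence G x = (\<Sum>i\<in>UNIV. partial_deriv i (\<lambda>y. G y $ i) x)"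

(* Class C^k, intended for open S (on which all derivatives below are unrestricted ones). *)
primrec Ck_on :: "nat \<Rightarrow> (real^'d::finite \<Rightarrow> real) \<Rightarrow> (real^'d) set \<Rightarrow> bool" where
  "Ck_on 0 f S \<longleftrightarrow> continuous_on S f"
| "Ck_on (Suc k) f S \<longleftrightarrow>
     (\<forall>x\<in>S. f differentiable (at x)) \<and> (\<forall>i. Ck_on k (partial_deriv i f) S)"

definition smooth_on :: "(real^'d::finite \<Rightarrow> real) \<Rightarrow> (real^'d) set \<Rightarrow> bool" where
  "smooth_on f S \<longleftrightarrow> (\<forall>k. Ck_on k f S)"

definition minimal_hypersurface_eq_at :: "(real^'d::finite \<Rightarrow> real) \<Rightarrow> real^'d \<Rightarrow> bool" where
  "minimal_hypersurface_eq_at F p \<longleftrightarrow>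
     divergence (\<lambda>x. gradient F x /\<^sub>R sqrt (1 + (norm (gradient F x))\<^sup>2)) p = 0"

(* A multi-valued function is a set-valued map, with empty value outside its domain. *)
definition local_smooth_branch ::
  "(real^'d::finite \<Rightarrow> real set) \<Rightarrow> (real^'d) set \<Rightarrow> (real^'d \<Rightarrow> real) \<Rightarrow> bool" where
  "local_smooth_branch \<Phi> S F \<longleftrightarrow> open S \<and> smooth_on F S \<and> (\<forall>p\<in>S. F p \<in> \<Phi> p)"

definition minimal_multigraph :: "(real^'d::finite \<Rightarrow> real set) \<Rightarrow> bool" where
  "minimal_multigraph \<Phi> \<longleftrightarrow>
     (\<forall>S F. local_smooth_branch \<Phi> S F \<longrightarrow> (\<forall>p\<in>S. minimal_hypersurface_eq_at F p))"

definition mv_lincomb :: "nat \<Rightarrow> (nat \<Rightarrow> real) \<Rightarrow> (nat \<Rightarrow> 'p \<Rightarrow> real set) \<Rightarrow> 'p \<Rightarrow> real set" where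
  "mv_lincomb m \<mu> \<Phi> p = {\<Sum>j=1..m. \<mu> j * v j |v. \<forall>j\<in>{1..m}. v j \<in> \<Phi> j p}"

(* A vector of R^n is given here by its components X 1, ..., X n. *)
definition CH_U :: "nat \<Rightarrow> (nat \<Rightarrow> real) \<Rightarrow> (nat \<Rightarrow> real) \<Rightarrow> real" where
  "CH_U n X Y = (L2_set X {1..n})\<^sup>2 - (L2_set Y {1..n})\<^sup>2"

definition CH_V :: "nat \<Rightarrow> (nat \<Rightarrow> real) \<Rightarrow> (nat \<Rightarrow> real) \<Rightarrow> real" where
  "CH_V n X Y = 2 * (\<Sum>k=1..n. X k * Y k)"

(* The guard is needed since every real number is an argument of 0 according to is_Arg. *)
definition CH_height :: "nat \<Rightarrow> (nat \<Rightarrow> real) \<Rightarrow> (nat \<Rightarrow> real) \<Rightarrow> real set" where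
  "CH_height n X Y =
     {\<theta> / 2 |\<theta>. (CH_U n X Y, CH_V n X Y) \<noteq> (0, 0) \<and> is_Arg (Complex (CH_U n X Y) (CH_V n X Y)) \<theta>}"

lemma Complex_CH_U_CH_V:
  "Complex (CH_U n X Y) (CH_V n X Y) = (\<Sum>k=1..n. (Complex (X k) (Y k))\<^sup>2)"
  by (simp add: complex_eq_iff CH_U_def CH_V_def L2_set_def sum_nonneg power2_eq_square
      sum_subtractf sum_distrib_left mult_ac)

datatype part = XPart | YPart

definition coord_labels :: "nat \<Rightarrow> (nat \<Rightarrow> nat) \<Rightarrow> (nat \<times> nat \<times> part) set" where
  "coord_labels m n = {(j, k, s). j \<in> {1..m} \<and> k \<in> {1..n j}}"

(* The product R^(2 n_1) x ... x R^(2 n_m) is real^'d, with its standard coordinates labelled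
   bijectively by coord_labels m n: c (j, k, XPart) and c (j, k, YPart) are the positions of
   the k-th components of X_j and Y_j. *)
definition product_coords ::
  "nat \<Rightarrow> (nat \<Rightarrow> nat) \<Rightarrow> (nat \<times> nat \<times> part \<Rightarrow> 'd::finite) \<Rightarrow> bool" where
  "product_coords m n c \<longleftrightarrow> bij_betw c (coord_labels m n) UNIV"

definition block :: "(nat \<times> nat \<times> part \<Rightarrow> 'd::finite) \<Rightarrow> part \<Rightarrow> nat \<Rightarrow> real^'d \<Rightarrow> nat \<Rightarrow> real" where
  "block c s j p = (\<lambda>k. p $ c (j, k, s))"

lemma UNIV_part: "(UNIV :: part set) = {XPart, YPart}"
  using part.exhaust by auto

lemma DIM_graph_space:
  fixes c :: "nat \<times> nat \<times> part \<Rightarrow> 'd::finite"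
  assumes "product_coords m n c"
  shows "DIM((real^'d) \<times> real) = (\<Sum>j=1..m. 2 * n j) + 1"
proof -
  have "coord_labels m n = (SIGMA j:{1..m}. {1..n j} \<times> UNIV)"
    by (auto simp: coord_labels_def)
  then have "card (coord_labels m n) = (\<Sum>j=1..m. 2 * n j)"
    by (simp add: UNIV_part card_cartesian_product mult_2)
  moreover have "card (coord_labels m n) = CARD('d)"
    using assms bij_betw_same_card unfolding product_coords_def by blast
  ultimately show ?thesis by simp
qed

end

theory Submission
  imports Defs
begin

text \<open>
  In the complex coordinates \<open>z\<^bsub>j,k\<^esub> = x\<^bsub>j,k\<^esub> + \<i> y\<^bsub>j,k\<^esub>\<close> put \<open>q\<^sub>j = \<Sum>\<^sub>k z\<^bsub>j,k\<^esub>\<^sup>2\<close>. A smooth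
  branch \<open>F\<close> of the multi-valued function is locally the imaginary part of the holomorphic function
  \<open>\<Sum>\<^sub>j (\<mu>\<^sub>j/2) log q\<^sub>j\<close>, up to a constant. For arbitrary real \<open>\<mu>\<^sub>j\<close> the possible constants may be
  dense in the reals, but there are only countably many of them, so continuity on a ball forces a
  single one (\<open>branch_has_gradient\<close>).

  Expanding the divergence, the minimal hypersurface equation becomes
  \<open>(1 + |\<nabla>F|\<^sup>2) \<Delta>F = \<langle>\<nabla>F, D(\<nabla>F)[\<nabla>F]\<rangle>\<close>. Here both sides vanish, which suffices
  (\<open>minimal_hypersurface_eq_atI\<close>). The Laplacian vanishes because \<open>F\<close> is the imaginary part of a
  holomorphic function (\<open>trace_branch_hessian\<close>). The right-hand side is half the derivative of
  \<open>|\<nabla>F|\<^sup>2 = \<Sum>\<^sub>j \<mu>\<^sub>j\<^sup>2 \<Sum>\<^sub>k |z\<^bsub>j,k\<^esub>|\<^sup>2 / |q\<^sub>j|\<^sup>2\<close> along \<open>\<nabla>F\<close>. It splits into one term for each block,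
  and each is zero (\<open>branch_infinity_harmonic\<close>): to first order, moving along \<open>\<nabla>F\<close> turns the
  argument of \<open>q\<^sub>j\<close> but changes neither \<open>|q\<^sub>j|\<close> nor \<open>\<Sum>\<^sub>k |z\<^bsub>j,k\<^esub>|\<^sup>2\<close>. Since the blocks do not
  interact, the coefficients \<open>\<mu>\<^sub>j\<close> can be arbitrary.
\<close>

section \<open>Harmonic and infinity-harmonic functions have minimal graphs\<close>

text \<open>
  By the quotient rule the divergence of \<open>G / sqrt (1 + |G|\<^sup>2)\<close> is the trace of \<open>G'\<close> over \<open>s\<close> minus
  \<open>G \<bullet> G' G\<close> over \<open>s\<^sup>3\<close>, where \<open>s = sqrt (1 + |G|\<^sup>2)\<close>. The gradient is required on a whole
  neighbourhood because it is differentiated once more.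
\<close>

lemma minimal_hypersurface_eq_atI:
  fixes F :: "real^'d::finite \<Rightarrow> real" and G :: "real^'d \<Rightarrow> real^'d"
  assumes T: "open T" "p \<in> T"
    and F: "\<And>x. x \<in> T \<Longrightarrow> (F has_derivative (\<lambda>h. G x \<bullet> h)) (at x)"
    and G: "(G has_derivative G') (at p)"
    and harmonic: "(\<Sum>i\<in>UNIV. G' (axis i 1) $ i) = 0"
    and infinity_harmonic: "G p \<bullet> G' (G p) = 0"
  shows "minimal_hypersurface_eq_at F p"
proof -
  have grad: "gradient F x = G x" if "x \<in> T" for x
    by (simp add: gradient_def partial_deriv_def vec_eq_iff inner_axis
        frechet_derivative_at[OF F[OF that], symmetric])
  define s where "s = sqrt (1 + G p \<bullet> G p)"
  have pos: "1 + G p \<bullet> G p > 0"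
    by (simp add: add_pos_nonneg)
  then have s: "s > 0"
    by (simp add: s_def)
  have lin: "linear G'"
    using G has_derivative_linear by blast
  define D where "D i h = G' h $ i / s - G p $ i * (G p \<bullet> G' h) / s ^ 3" for i h
  have deriv: "partial_deriv i (\<lambda>x. (gradient F x /\<^sub>R sqrt (1 + (norm (gradient F x))\<^sup>2)) $ i) p
      = D i (axis i 1)" for i
  proof -
    have Gi: "((\<lambda>y. G y $ i) has_derivative (\<lambda>h. G' h $ i)) (at p)"
      by (rule bounded_linear.has_derivative[OF bounded_linear_vec_nth G])
    have "((\<lambda>y. sqrt (1 + G y \<bullet> G y)) has_derivative
        (\<lambda>h. (G p \<bullet> G' h) / s)) (at p)"
      using pos s
      by (auto intro!: derivative_eq_intros G simp: s_def inner_commute divide_simps)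
    from has_derivative_divide[OF Gi this]
    have "((\<lambda>y. G y $ i / sqrt (1 + G y \<bullet> G y)) has_derivative D i) (at p)"
      using s pos unfolding s_def[symmetric]
      by (auto simp: D_def[abs_def] field_simps power3_eq_cube)
    then have "((\<lambda>x. (gradient F x /\<^sub>R sqrt (1 + (norm (gradient F x))\<^sup>2)) $ i)
        has_derivative D i) (at p)"
      by (rule has_derivative_transform_within_open[OF _ T])
        (simp add: grad dot_square_norm divide_inverse_commute)
    then show ?thesis
      by (simp add: partial_deriv_def frechet_derivative_at[symmetric])
  qed
  have "(\<Sum>i\<in>UNIV. G p $ i * (G p \<bullet> G' (axis i 1)))
      = G p \<bullet> G' (\<Sum>i\<in>UNIV. G p $ i *\<^sub>R axis i 1)"
    by (simp add: linear_sum[OF lin] linear_cmul[OF lin] inner_sum_right)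
  also have "(\<Sum>i\<in>UNIV. G p $ i *\<^sub>R axis i 1) = G p"
    using basis_expansion[of "G p"] by (simp add: scalar_mult_eq_scaleR)
  finally have "(\<Sum>i\<in>UNIV. G p $ i * (G p \<bullet> G' (axis i 1))) = 0"
    using infinity_harmonic by simp
  then have "(\<Sum>i\<in>UNIV. D i (axis i 1)) = 0"
    using harmonic by (simp add: D_def sum_subtractf sum_divide_distrib[symmetric])
  then show ?thesis
    unfolding minimal_hypersurface_eq_at_def divergence_def deriv .
qed

section \<open>Arguments and continuous selections from countable sets\<close>

text \<open>
  Near \<open>a\<close> the quotient \<open>z / a\<close> is close to 1, hence away from the branch cut of \<open>Ln\<close>. This makes
  every choice of argument of \<open>z\<close> comparable with one smooth function of \<open>z\<close>, even if \<open>a\<close> is a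
  negative real number.
\<close>

lemma is_Arg_divide_Ln:
  assumes "is_Arg z \<theta>" "is_Arg a \<alpha>" "z \<noteq> 0" "a \<noteq> 0"
  shows "\<exists>k::int. \<theta> = Im (Ln (z / a)) + \<alpha> + 2 * pi * k"
proof -
  define \<beta> where "\<beta> = Im (Ln (z / a))"
  have "is_Arg (z / a) \<beta>"
    using assms Arg_eq_Im_Ln[of "z / a"] Arg_eq[of "z / a"] by (simp add: \<beta>_def is_Arg_def)
  moreover have "exp (\<i> * t) = w / norm w" if "is_Arg w t" "w \<noteq> 0" for w t
  proof -
    have "exp (\<i> * t) = norm w * exp (\<i> * t) / norm w"
      using that by simp
    also have "norm w * exp (\<i> * t) = w"
      using that by (simp only: is_Arg_def)
    finally show ?thesis .
  qed
  ultimately have "exp (\<i> * \<theta>) = z / norm z" "exp (\<i> * \<alpha>) = a / norm a"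
    "exp (\<i> * \<beta>) = (z / a) / norm (z / a)"
    using assms by auto
  then have "exp (\<i> * \<theta>) = exp (\<i> * \<beta> + \<i> * \<alpha>)"
    using assms by (simp add: exp_add norm_divide)
  then obtain k :: int where
    "\<i> * complex_of_real \<theta> = \<i> * \<beta> + \<i> * \<alpha> + 2 * of_int k * pi * \<i>"
    unfolding exp_eq by (auto simp: algebra_simps)
  then have "Im (\<i> * complex_of_real \<theta>) = Im (\<i> * \<beta> + \<i> * \<alpha> + 2 * of_int k * pi * \<i>)"
    by (simp only:)
  then show ?thesis
    by (intro exI[of _ k]) (simp add: \<beta>_def)
qed

lemma countable_sums:
  fixes \<mu> :: "'i \<Rightarrow> real"
  assumes "finite I" "\<And>j. j \<in> I \<Longrightarrow> countable (C j)"
  shows "countable {\<Sum>j\<in>I. \<mu> j * v j |v. \<forall>j\<in>I. v j \<in> C j}"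
proof -
  have "{\<Sum>j\<in>I. \<mu> j * v j |v. \<forall>j\<in>I. v j \<in> C j} \<subseteq> (\<lambda>v. \<Sum>j\<in>I. \<mu> j * v j) ` (Pi\<^sub>E I C)"
  proof safe
    fix v assume v: "\<forall>j\<in>I. v j \<in> C j"
    then show "(\<Sum>j\<in>I. \<mu> j * v j) \<in> (\<lambda>v. \<Sum>j\<in>I. \<mu> j * v j) ` (Pi\<^sub>E I C)"
      by (intro image_eqI[of _ _ "restrict v I"]) auto
  qed
  moreover have "countable (Pi\<^sub>E I C)"
    using assms by (intro countable_PiE) auto
  ultimately show ?thesis
    by (meson countable_image countable_subset)
qed

text \<open>
  The image is connected, and a connected set of reals with two points is uncountable. Discreteness
  of \<open>C\<close> would be too strong to ask: the combinations to which this is applied may be dense.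
\<close>

lemma continuous_countable_range_constant:
  fixes f :: "'a::topological_space \<Rightarrow> real"
  assumes "connected B" "continuous_on B f" "f ` B \<subseteq> C" "countable C" "x \<in> B" "y \<in> B"
  shows "f x = f y"
proof (rule ccontr)
  assume "f x \<noteq> f y"
  then have "uncountable (f ` B)"
    using assms(5,6) connected_continuous_image[OF assms(2,1)]
    by (intro connected_uncountable[of _ "f x" "f y"]) auto
  then show False
    using countable_subset[OF assms(3,4)] by contradiction
qed

section \<open>Complex coordinates on the product space\<close>

locale complex_blocks =
  fixes m :: nat and n :: "nat \<Rightarrow> nat" and c :: "nat \<times> nat \<times> part \<Rightarrow> 'd::finite"
  assumes coords: "product_coords m n c"
begin

definition zcoord :: "nat \<Rightarrow> nat \<Rightarrow> real^'d \<Rightarrow> complex" where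
  "zcoord j k p = Complex (p $ c (j, k, XPart)) (p $ c (j, k, YPart))"

definition quad :: "nat \<Rightarrow> real^'d \<Rightarrow> complex" where
  "quad j p = (\<Sum>k=1..n j. (zcoord j k p)\<^sup>2)"

text \<open>Inverse to \<open>zcoord\<close>, so that a gradient can be given by its complex coordinates.\<close>

definition of_zcoord :: "(nat \<Rightarrow> nat \<Rightarrow> complex) \<Rightarrow> real^'d" where
  "of_zcoord \<xi> = (\<chi> i. case inv_into (coord_labels m n) c i of
     (j, k, XPart) \<Rightarrow> Re (\<xi> j k) | (j, k, YPart) \<Rightarrow> Im (\<xi> j k))"

lemma bij_c: "bij_betw c (coord_labels m n) UNIV"
  using coords by (simp add: product_coords_def)

lemma c_eq_iff:
  assumes "j \<in> {1..m}" "k \<in> {1..n j}" "j' \<in> {1..m}" "k' \<in> {1..n j'}"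
  shows "c (j, k, s) = c (j', k', s') \<longleftrightarrow> j = j' \<and> k = k' \<and> s = s'"
proof -
  have "(j, k, s) \<in> coord_labels m n" "(j', k', s') \<in> coord_labels m n"
    using assms by (auto simp: coord_labels_def)
  then show ?thesis
    using bij_c by (auto simp: bij_betw_def dest: inj_onD)
qed

lemma sum_coords:
  fixes f :: "'d \<Rightarrow> 'b::comm_monoid_add"
  shows "(\<Sum>i\<in>UNIV. f i) = (\<Sum>j=1..m. \<Sum>k=1..n j. f (c (j, k, XPart)) + f (c (j, k, YPart)))"
proof -
  have "coord_labels m n = (SIGMA j:{1..m}. SIGMA k:{1..n j}. UNIV)"
    by (auto simp: coord_labels_def)
  then have "(\<Sum>i\<in>UNIV. f i) = (\<Sum>t\<in>(SIGMA j:{1..m}. SIGMA k:{1..n j}. UNIV). f (c t))"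
    using sum.reindex_bij_betw[OF bij_c, of f] by simp
  also have "\<dots> = (\<Sum>(j, k, s)\<in>(SIGMA j:{1..m}. SIGMA k:{1..n j}. UNIV). f (c (j, k, s)))"
    by (simp add: split_def)
  also have "\<dots> = (\<Sum>j=1..m. \<Sum>(k, s)\<in>{1..n j} \<times> UNIV. f (c (j, k, s)))"
    by (rule sum.Sigma[symmetric]) (auto simp: UNIV_part)
  also have "\<dots> = (\<Sum>j=1..m. \<Sum>k=1..n j. \<Sum>s\<in>UNIV. f (c (j, k, s)))"
    by (simp only: sum.cartesian_product)
  finally show ?thesis
    by (simp add: UNIV_part)
qed

lemma zcoord_of_zcoord:
  assumes "j \<in> {1..m}" "k \<in> {1..n j}"
  shows "zcoord j k (of_zcoord \<xi>) = \<xi> j k"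
proof -
  have "inv_into (coord_labels m n) c (c (j, k, s)) = (j, k, s)" for s
    using assms bij_c by (intro inv_into_f_f) (auto simp: bij_betw_def coord_labels_def)
  then show ?thesis
    by (simp add: zcoord_def of_zcoord_def complex_eq_iff)
qed

lemma zcoord_axis:
  assumes "j \<in> {1..m}" "k \<in> {1..n j}" "j' \<in> {1..m}" "k' \<in> {1..n j'}"
  shows "zcoord j' k' (axis (c (j, k, XPart)) 1) = of_bool (j' = j \<and> k' = k)"
    and "zcoord j' k' (axis (c (j, k, YPart)) 1) = \<i> * of_bool (j' = j \<and> k' = k)"
  using c_eq_iff[OF assms(3,4,1,2)]
  by (auto simp: zcoord_def axis_def complex_eq_iff)

lemma inner_zcoord: "u \<bullet> v = (\<Sum>j=1..m. \<Sum>k=1..n j. Re (cnj (zcoord j k u) * zcoord j k v))"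
  by (simp add: inner_vec_def sum_coords zcoord_def)

lemma bounded_linear_zcoord: "bounded_linear (zcoord j k)"
proof -
  have "zcoord j k = (\<lambda>p. of_real (p $ c (j, k, XPart)) + \<i> * of_real (p $ c (j, k, YPart)))"
    by (auto simp: zcoord_def complex_eq_iff)
  moreover have "bounded_linear \<dots>"
    by (intro bounded_linear_add bounded_linear_const_mult bounded_linear_of_real
        bounded_linear_compose[OF bounded_linear_of_real] bounded_linear_vec_nth)
  ultimately show ?thesis by simp
qed

lemmas has_derivative_zcoord [derivative_intros] =
  bounded_linear.has_derivative[OF bounded_linear_zcoord]

definition dquad :: "nat \<Rightarrow> real^'d \<Rightarrow> real^'d \<Rightarrow> complex" where
  "dquad j p h = (\<Sum>k=1..n j. 2 * zcoord j k p * zcoord j k h)"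

lemma has_derivative_quad: "(quad j has_derivative dquad j p) (at p)"
  unfolding quad_def[abs_def] dquad_def[abs_def]
  by (auto intro!: derivative_eq_intros sum.cong simp: fun_eq_iff)

text \<open>
  Differentiability is tested against inner products, because \<open>inner_zcoord\<close> sees only the coordinates
  with labels in range, where the hypothesis is available.
\<close>

lemma has_derivative_of_zcoord:
  assumes \<xi>: "\<And>j k. j \<in> {1..m} \<Longrightarrow> k \<in> {1..n j} \<Longrightarrow>
    ((\<lambda>x. \<xi> x j k) has_derivative (\<lambda>h. \<xi>' h j k)) (at p)"
  shows "((\<lambda>x. of_zcoord (\<xi> x)) has_derivative (\<lambda>h. of_zcoord (\<xi>' h))) (at p)"
proof -
  have inner: "of_zcoord \<eta> \<bullet> b = (\<Sum>j=1..m. \<Sum>k=1..n j. Re (cnj (\<eta> j k) * zcoord j k b))" for \<eta> b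
    unfolding inner_zcoord by (intro sum.cong refl) (simp only: zcoord_of_zcoord)
  have "((\<lambda>x. of_zcoord (\<xi> x) \<bullet> b) has_derivative (\<lambda>h. of_zcoord (\<xi>' h) \<bullet> b)) (at p)" for b
    unfolding inner
    by (intro has_derivative_sum has_derivative_Re has_derivative_mult_left has_derivative_cnj \<xi>)
  then show ?thesis
    by (subst has_derivative_componentwise_within) blast
qed

section \<open>Gradient and Hessian of a branch\<close>

text \<open>The complex partial derivative of \<open>log (quad j) / 2\<close> with respect to \<open>zcoord j k\<close>.\<close>

definition slope :: "nat \<Rightarrow> nat \<Rightarrow> real^'d \<Rightarrow> complex" where
  "slope j k p = zcoord j k p / quad j p"

definition dslope :: "nat \<Rightarrow> nat \<Rightarrow> real^'d \<Rightarrow> real^'d \<Rightarrow> complex" where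
  "dslope j k p h = zcoord j k h / quad j p - zcoord j k p * dquad j p h / (quad j p)\<^sup>2"

lemma has_derivative_slope:
  assumes "quad j p \<noteq> 0"
  shows "(slope j k has_derivative dslope j k p) (at p)"
proof -
  have "((\<lambda>x. zcoord j k x / quad j x) has_derivative
      (\<lambda>h. - zcoord j k p * (inverse (quad j p) * dquad j p h * inverse (quad j p))
        + zcoord j k h / quad j p)) (at p)"
    by (intro has_derivative_divide has_derivative_zcoord has_derivative_quad has_derivative_ident assms)
  moreover have "(\<lambda>h. - zcoord j k p * (inverse (quad j p) * dquad j p h * inverse (quad j p))
        + zcoord j k h / quad j p) = dslope j k p"
    by (simp add: fun_eq_iff dslope_def field_simps power2_eq_square)
  ultimately show ?thesis
    by (simp add: slope_def[abs_def])
qed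

text \<open>
  For holomorphic \<open>f\<close> the real gradient of \<open>Im f\<close> has the complex coordinates \<open>\<i> * cnj (f')\<close>, because
  its inner product with \<open>h\<close> is \<open>Im (f' * h) = Re (cnj (\<i> * cnj f') * h)\<close>. Here
  \<open>f = (\<Sum>j. \<mu> j * log (quad j) / 2)\<close>.
\<close>

definition branch_gradient :: "(nat \<Rightarrow> real) \<Rightarrow> real^'d \<Rightarrow> real^'d" where
  "branch_gradient \<mu> p = of_zcoord (\<lambda>j k. \<i> * \<mu> j * cnj (slope j k p))"

definition branch_hessian :: "(nat \<Rightarrow> real) \<Rightarrow> real^'d \<Rightarrow> real^'d \<Rightarrow> real^'d" where
  "branch_hessian \<mu> p h = of_zcoord (\<lambda>j k. \<i> * \<mu> j * cnj (dslope j k p h))"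

lemma has_derivative_branch_gradient:
  assumes "\<And>j. j \<in> {1..m} \<Longrightarrow> quad j p \<noteq> 0"
  shows "(branch_gradient \<mu> has_derivative branch_hessian \<mu> p) (at p)"
  unfolding branch_gradient_def[abs_def] branch_hessian_def[abs_def]
  by (intro has_derivative_of_zcoord has_derivative_mult_right has_derivative_cnj has_derivative_slope assms)

text \<open>
  This is the Cauchy-Riemann equation for \<open>slope j k\<close>: its derivative is complex linear in
  the coordinate \<open>zcoord j k\<close>, so the two diagonal entries belonging to that coordinate cancel.
\<close>

lemma trace_branch_hessian: "(\<Sum>i\<in>UNIV. branch_hessian \<mu> p (axis i 1) $ i) = 0"
proof -
  have "branch_hessian \<mu> p (axis (c (j, k, XPart)) 1) $ c (j, k, XPart)
      + branch_hessian \<mu> p (axis (c (j, k, YPart)) 1) $ c (j, k, YPart) = 0"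
    if jk: "j \<in> {1..m}" "k \<in> {1..n j}" for j k
  proof -
    have dq: "dquad j p (axis (c (j, k, XPart)) 1) = 2 * zcoord j k p"
      "dquad j p (axis (c (j, k, YPart)) 1) = \<i> * (2 * zcoord j k p)"
    proof -
      have "dquad j p (axis (c (j, k, XPart)) 1) = (\<Sum>l=1..n j. if l = k then 2 * zcoord j l p else 0)"
        "dquad j p (axis (c (j, k, YPart)) 1) = (\<Sum>l=1..n j. if l = k then \<i> * (2 * zcoord j l p) else 0)"
        unfolding dquad_def by (intro sum.cong refl; simp add: zcoord_axis[OF jk jk(1)])+
      then show "dquad j p (axis (c (j, k, XPart)) 1) = 2 * zcoord j k p"
        "dquad j p (axis (c (j, k, YPart)) 1) = \<i> * (2 * zcoord j k p)"
        using jk(2) by simp_all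
    qed
    have "dslope j k p (axis (c (j, k, YPart)) 1) = \<i> * dslope j k p (axis (c (j, k, XPart)) 1)"
      using jk by (simp add: dslope_def dq zcoord_axis[OF jk jk] algebra_simps)
    moreover have "v $ c (j, k, XPart) = Re (zcoord j k v)" "v $ c (j, k, YPart) = Im (zcoord j k v)" for v
      by (simp_all add: zcoord_def)
    ultimately show ?thesis
      by (simp add: branch_hessian_def zcoord_of_zcoord[OF jk])
  qed
  then show ?thesis
    by (simp add: sum_coords)
qed

text \<open>
  Fix a block and write \<open>z\<^sub>k\<close> for its coordinates, \<open>q = \<Sum>\<^sub>k z\<^sub>k\<^sup>2\<close> and \<open>A = \<Sum>\<^sub>k |z\<^sub>k|\<^sup>2\<close>. Along the gradient
  \<open>z\<^sub>k\<close> moves with velocity \<open>\<i> \<mu> cnj z\<^sub>k / cnj q\<close>, hence \<open>q\<close> moves with velocity \<open>2 \<i> \<mu> A / cnj q\<close>. With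
  these, the sums over \<open>k\<close> collapse to \<open>q\<close> and \<open>A\<close>, and the contribution of the block is the real part
  of \<open>\<i>\<close> times a real number.
\<close>

lemma branch_infinity_harmonic:
  assumes nz: "\<And>j. j \<in> {1..m} \<Longrightarrow> quad j p \<noteq> 0"
  shows "branch_gradient \<mu> p \<bullet> branch_hessian \<mu> p (branch_gradient \<mu> p) = 0"
proof -
  have "(\<Sum>k=1..n j. Re (cnj (zcoord j k (branch_gradient \<mu> p)) * zcoord j k (branch_hessian \<mu> p (branch_gradient \<mu> p)))) = 0"
    if j: "j \<in> {1..m}" for j
  proof -
    define q where "q = quad j p"
    define A where "A = (\<Sum>k=1..n j. (norm (zcoord j k p))\<^sup>2)"
    have q: "q \<noteq> 0"
      using nz[OF j] by (simp add: q_def)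
    \<comment> \<open>\<open>N\<close> is \<open>|q|\<^sup>2\<close>, kept opaque so that both sides below are rational in \<open>q\<close>, \<open>cnj q\<close> and \<open>A\<close>.\<close>
    obtain N :: real where N: "complex_of_real N = q * cnj q"
      using complex_norm_square[of q] by metis
    have zg: "zcoord j k (branch_gradient \<mu> p) = \<i> * \<mu> j * cnj (zcoord j k p) / cnj q" if "k \<in> {1..n j}" for k
      using that j by (simp add: branch_gradient_def zcoord_of_zcoord slope_def q_def)
    have Q: "q = (\<Sum>k=1..n j. (zcoord j k p)\<^sup>2)"
      by (simp add: q_def quad_def)
    have A: "complex_of_real A = (\<Sum>k=1..n j. zcoord j k p * cnj (zcoord j k p))"
      by (simp only: A_def of_real_sum complex_norm_square)
    have "dquad j p (branch_gradient \<mu> p) = (\<Sum>k=1..n j. 2 * \<i> * \<mu> j / cnj q * (zcoord j k p * cnj (zcoord j k p)))"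
      unfolding dquad_def by (intro sum.cong refl) (simp add: zg)
    then have dq: "dquad j p (branch_gradient \<mu> p) = 2 * \<i> * \<mu> j * A / cnj q"
      by (simp only: A sum_distrib_left sum_divide_distrib times_divide_eq_left)
    have "cnj (zcoord j k (branch_gradient \<mu> p)) * zcoord j k (branch_hessian \<mu> p (branch_gradient \<mu> p))
        = - \<i> * \<mu> j ^ 3 / (q * q * cnj q) * (zcoord j k p)\<^sup>2
          + 2 * \<i> * \<mu> j ^ 3 * A / (q * q * cnj q * cnj q) * (zcoord j k p * cnj (zcoord j k p))"
      if "k \<in> {1..n j}" for k
      using q that j
      by (simp add: zg branch_hessian_def zcoord_of_zcoord dslope_def dq flip: q_def)
        (simp add: field_simps power2_eq_square power3_eq_cube)
    then have "(\<Sum>k=1..n j. cnj (zcoord j k (branch_gradient \<mu> p)) * zcoord j k (branch_hessian \<mu> p (branch_gradient \<mu> p)))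
        = - \<i> * \<mu> j ^ 3 / (q * q * cnj q) * q
          + 2 * \<i> * \<mu> j ^ 3 * A / (q * q * cnj q * cnj q) * A"
      by (simp only: sum.cong[OF refl] sum.distrib flip: sum_distrib_left A Q)
    also have "- \<i> * \<mu> j ^ 3 / (q * q * cnj q) * q
        + 2 * \<i> * \<mu> j ^ 3 * A / (q * q * cnj q * cnj q) * A
        = \<i> * complex_of_real (- (\<mu> j ^ 3) / N + 2 * \<mu> j ^ 3 * A\<^sup>2 / N\<^sup>2)"
      using q by (simp add: N field_simps power2_eq_square)
    finally show ?thesis
      by (simp only: flip: Re_sum) simp
  qed
  then show ?thesis
    by (simp add: inner_zcoord)
qed

section \<open>Local branches are imaginary parts of logarithms\<close>

text \<open>
  Normalising by the constants \<open>a j\<close>, in practice the values of \<open>quad j\<close> at a base point, keeps \<open>Ln\<close>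
  away from its cut; these constants drop out of the derivative.
\<close>

lemma has_derivative_Arg_sum:
  fixes \<mu> :: "nat \<Rightarrow> real"
  assumes "\<And>j. j \<in> {1..m} \<Longrightarrow> a j \<noteq> 0 \<and> Re (quad j x / a j) > 0"
  shows "((\<lambda>x. \<Sum>j=1..m. \<mu> j * (Im (Ln (quad j x / a j)) / 2)) has_derivative
    (\<lambda>h. branch_gradient \<mu> x \<bullet> h)) (at x)"
proof -
  have "((\<lambda>x. \<mu> j * (Im (Ln (quad j x / a j)) / 2)) has_derivative
      (\<lambda>h. \<mu> j * (Im (dquad j x h / quad j x) / 2))) (at x)" if j: "j \<in> {1..m}" for j
  proof -
    have nz: "a j \<noteq> 0" "quad j x \<noteq> 0" and "quad j x / a j \<notin> \<real>\<^sub>\<le>\<^sub>0"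
      using assms[OF j] by (auto simp: complex_nonpos_Reals_iff)
    then have "(Ln has_derivative (\<lambda>h. inverse (quad j x / a j) * h)) (at (quad j x / a j))"
      using has_field_derivative_Ln unfolding has_field_derivative_def by blast
    from has_derivative_compose[OF bounded_linear.has_derivative
        [OF bounded_linear_divide has_derivative_quad] this]
    have "((\<lambda>x. Ln (quad j x / a j)) has_derivative
        (\<lambda>h. inverse (quad j x / a j) * (dquad j x h / a j))) (at x)" .
    also have "(\<lambda>h. inverse (quad j x / a j) * (dquad j x h / a j)) = (\<lambda>h. dquad j x h / quad j x)"
      using nz by simp
    finally show ?thesis
      by (intro has_derivative_mult_right has_derivative_Im
          bounded_linear.has_derivative[OF bounded_linear_divide])
  qed
  then have "((\<lambda>x. \<Sum>j=1..m. \<mu> j * (Im (Ln (quad j x / a j)) / 2)) has_derivative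
      (\<lambda>h. \<Sum>j=1..m. \<mu> j * (Im (dquad j x h / quad j x) / 2))) (at x)"
    by (rule has_derivative_sum)
  moreover have "\<mu> j * (Im (dquad j x h / quad j x) / 2)
      = (\<Sum>k=1..n j. Re (cnj (zcoord j k (branch_gradient \<mu> x)) * zcoord j k h))" if "j \<in> {1..m}" for j h
  proof -
    have "\<mu> j * (Im (dquad j x h / quad j x) / 2)
        = (\<Sum>k=1..n j. \<mu> j * (Im (2 * zcoord j k x * zcoord j k h / quad j x) / 2))"
      by (simp only: dquad_def sum_divide_distrib Im_sum sum_distrib_left)
    also have "\<dots> = (\<Sum>k=1..n j. Re (cnj (zcoord j k (branch_gradient \<mu> x)) * zcoord j k h))"
    proof (rule sum.cong[OF refl])
      fix k assume k: "k \<in> {1..n j}"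
      have e: "2 * zcoord j k x * zcoord j k h / quad j x = 2 * (slope j k x * zcoord j k h)"
        by (simp add: slope_def)
      show "\<mu> j * (Im (2 * zcoord j k x * zcoord j k h / quad j x) / 2)
          = Re (cnj (zcoord j k (branch_gradient \<mu> x)) * zcoord j k h)"
        unfolding e using that k by (simp add: branch_gradient_def zcoord_of_zcoord algebra_simps)
    qed
    finally show ?thesis .
  qed
  then have "(\<lambda>h. \<Sum>j=1..m. \<mu> j * (Im (dquad j x h / quad j x) / 2)) = (\<lambda>h. branch_gradient \<mu> x \<bullet> h)"
    unfolding inner_zcoord by (intro ext sum.cong refl)
  ultimately show ?thesis
    by (simp only:)
qed

lemma Complex_CH_eq_quad:
  "Complex (CH_U (n j) (block c XPart j p) (block c YPart j p))
     (CH_V (n j) (block c XPart j p) (block c YPart j p)) = quad j p"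
  by (simp add: Complex_CH_U_CH_V quad_def zcoord_def block_def)

lemma mem_CH_height_iff:
  "v \<in> CH_height (n j) (block c XPart j p) (block c YPart j p)
    \<longleftrightarrow> quad j p \<noteq> 0 \<and> is_Arg (quad j p) (2 * v)"
proof -
  have "(CH_U (n j) (block c XPart j p) (block c YPart j p),
      CH_V (n j) (block c XPart j p) (block c YPart j p)) \<noteq> (0, 0) \<longleftrightarrow> quad j p \<noteq> 0"
    by (simp add: complex_eq_iff flip: Complex_CH_eq_quad)
  moreover have "v = \<theta> / 2 \<longleftrightarrow> \<theta> = 2 * v" for \<theta>
    by auto
  ultimately show ?thesis
    unfolding CH_height_def Complex_CH_eq_quad by (simp add: mult.commute)
qed

lemma continuous_on_quad: "continuous_on A (quad j)"
  by (rule continuous_at_imp_continuous_on) (use has_derivative_quad has_derivative_continuous in blast)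

text \<open>
  At each point \<open>F\<close> is a combination of arguments of the \<open>quad j\<close>, but these arguments may be chosen
  discontinuously in the point. Subtracting the continuous reference branch \<open>\<Theta>\<close> leaves a continuous
  function with values in the countable set \<open>C\<close>, whose elements differ only by the integer multiples
  of \<open>2 * pi\<close> allowed in each argument. This function is therefore constant on a ball.
\<close>

lemma branch_has_gradient:
  fixes \<mu> :: "nat \<Rightarrow> real"
  assumes br: "local_smooth_branch
      (mv_lincomb m \<mu> (\<lambda>j p. CH_height (n j) (block c XPart j p) (block c YPart j p))) S F"
    and p: "p \<in> S"
  obtains T where "open T" "p \<in> T" "\<And>j x. j \<in> {1..m} \<Longrightarrow> x \<in> T \<Longrightarrow> quad j x \<noteq> 0"
    "\<And>x. x \<in> T \<Longrightarrow> (F has_derivative (\<lambda>h. branch_gradient \<mu> x \<bullet> h)) (at x)"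
proof -
  have "open S" and contF: "continuous_on S F"
    using br by (auto simp: local_smooth_branch_def smooth_on_def dest: spec[of _ 0])
  have F: "\<exists>v. F x = (\<Sum>j=1..m. \<mu> j * v j) \<and> (\<forall>j\<in>{1..m}. quad j x \<noteq> 0 \<and> is_Arg (quad j x) (2 * v j))"
    if "x \<in> S" for x
    using br that unfolding local_smooth_branch_def mv_lincomb_def mem_CH_height_iff by blast
  then have nz: "quad j x \<noteq> 0" if "x \<in> S" "j \<in> {1..m}" for x j
    using that by blast
  \<comment> \<open>On \<open>H\<close> each quotient lies in the right half-plane, where \<open>Ln\<close> is smooth.\<close>
  define H where "H = S \<inter> (\<Inter>j\<in>{1..m}. {x. 0 < Re (quad j x / quad j p)})"
  have "open H"
    unfolding H_def
    by (intro open_Int open_INT \<open>open S\<close> ballI finite_atLeastAtMost open_Collect_less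
        continuous_on_const continuous_on_Re continuous_on_divide continuous_on_quad)
      (use nz p in auto)
  moreover have "p \<in> H"
    using p nz by (auto simp: H_def)
  ultimately obtain e where e: "e > 0" "ball p e \<subseteq> H"
    using open_contains_ball by blast
  define B where "B = ball p e"
  have B: "x \<in> S" "\<And>j. j \<in> {1..m} \<Longrightarrow> quad j p \<noteq> 0 \<and> 0 < Re (quad j x / quad j p)"
    if "x \<in> B" for x
    using that e nz p by (auto simp: B_def H_def)
  define \<Theta> where "\<Theta> x = (\<Sum>j=1..m. \<mu> j * (Im (Ln (quad j x / quad j p)) / 2))" for x
  have der\<Theta>: "(\<Theta> has_derivative (\<lambda>h. branch_gradient \<mu> x \<bullet> h)) (at x)" if "x \<in> B" for x
    unfolding \<Theta>_def[abs_def] using B[OF that] by (intro has_derivative_Arg_sum) blast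
  define C where "C = {\<Sum>j\<in>{1..m}. \<mu> j * v j |v. \<forall>j\<in>{1..m}.
      v j \<in> range (\<lambda>k::int. (Arg (quad j p) + 2 * pi * k) / 2)}"
  have "F x - \<Theta> x \<in> C" if x: "x \<in> B" for x
  proof -
    from F[OF B(1)[OF x]] obtain v where v: "F x = (\<Sum>j=1..m. \<mu> j * v j)"
      "\<And>j. j \<in> {1..m} \<Longrightarrow> quad j x \<noteq> 0 \<and> is_Arg (quad j x) (2 * v j)"
      by blast
    have "v j - Im (Ln (quad j x / quad j p)) / 2
        \<in> range (\<lambda>k::int. (Arg (quad j p) + 2 * pi * k) / 2)" if j: "j \<in> {1..m}" for j
    proof -
      obtain k :: int where "2 * v j = Im (Ln (quad j x / quad j p)) + Arg (quad j p) + 2 * pi * k"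
        using is_Arg_divide_Ln[of "quad j x" "2 * v j" "quad j p" "Arg (quad j p)"]
          v(2)[OF j] nz[OF p j] is_Arg_Arg by blast
      then show ?thesis
        by (intro range_eqI[of _ _ k]) (simp add: field_simps)
    qed
    moreover have "F x - \<Theta> x = (\<Sum>j=1..m. \<mu> j * (v j - Im (Ln (quad j x / quad j p)) / 2))"
      by (simp add: v \<Theta>_def right_diff_distrib sum_subtractf)
    ultimately show ?thesis
      unfolding C_def mem_Collect_eq
      by (intro exI[of _ "\<lambda>j. v j - Im (Ln (quad j x / quad j p)) / 2"]) blast
  qed
  then have "(\<lambda>x. F x - \<Theta> x) ` B \<subseteq> C"
    by blast
  moreover have "countable C"
    unfolding C_def by (intro countable_sums) auto
  moreover have "continuous_on B \<Theta>"
    using der\<Theta> by (meson continuous_at_imp_continuous_on has_derivative_continuous)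
  then have "continuous_on B (\<lambda>x. F x - \<Theta> x)"
    using B(1) by (intro continuous_on_diff continuous_on_subset[OF contF]) auto
  moreover have "connected B" "p \<in> B"
    using e by (auto simp: B_def)
  ultimately have const: "F x - \<Theta> x = F p - \<Theta> p" if "x \<in> B" for x
    using continuous_countable_range_constant[of B "\<lambda>x. F x - \<Theta> x" C x p] that by blast
  show ?thesis
  proof (rule that)
    show "open B" "p \<in> B"
      using e by (auto simp: B_def)
    show "quad j x \<noteq> 0" if "j \<in> {1..m}" "x \<in> B" for j x
      using that B(1) nz by blast
    show "(F has_derivative (\<lambda>h. branch_gradient \<mu> x \<bullet> h)) (at x)" if "x \<in> B" for x
    proof (rule has_derivative_transform_within_open[OF _ \<open>open B\<close> that])
      show "((\<lambda>y. \<Theta> y + (F p - \<Theta> p)) has_derivative (\<lambda>h. branch_gradient \<mu> x \<bullet> h)) (at x)"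
        using has_derivative_add[OF der\<Theta>[OF that] has_derivative_const] by simp
      show "\<Theta> y + (F p - \<Theta> p) = F y" if "y \<in> B" for y
        using const[OF that] by simp
    qed
  qed
qed

end

theorem theorem1:
  fixes m :: nat and n :: "nat \<Rightarrow> nat" and \<mu> :: "nat \<Rightarrow> real"
    and c :: "nat \<times> nat \<times> part \<Rightarrow> 'd::finite"
  assumes "m \<ge> 1"
    and "\<And>j. j \<in> {1..m} \<Longrightarrow> n j \<ge> 1"
    and "product_coords m n c"
  shows "minimal_multigraph
    (mv_lincomb m \<mu> (\<lambda>j (p :: real^'d). CH_height (n j) (block c XPart j p) (block c YPart j p)))"
  unfolding minimal_multigraph_def
proof (intro allI impI ballI)
  interpret complex_blocks m n c
    using assms(3) by unfold_locales
  fix S F p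
  assume br: "local_smooth_branch (mv_lincomb m \<mu>
      (\<lambda>j (p :: real^'d). CH_height (n j) (block c XPart j p) (block c YPart j p))) S F"
    and p: "p \<in> S"
  obtain T where T: "open T" "p \<in> T" "\<And>j x. j \<in> {1..m} \<Longrightarrow> x \<in> T \<Longrightarrow> quad j x \<noteq> 0"
    "\<And>x. x \<in> T \<Longrightarrow> (F has_derivative (\<lambda>h. branch_gradient \<mu> x \<bullet> h)) (at x)"
    by (rule branch_has_gradient[OF br p]) (rule that; assumption)
  have nz: "quad j p \<noteq> 0" if "j \<in> {1..m}" for j
    by (rule T(3)[OF that T(2)])
  show "minimal_hypersurface_eq_at F p"
    by (rule minimal_hypersurface_eq_atI[OF T(1,2,4) has_derivative_branch_gradient[OF nz] trace_branch_hessian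
          branch_infinity_harmonic[OF nz]])
qed

end
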